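(* Let $G$ be a finite directed graph with a global sink, with a fixed cyclic ordering of the outgoing edges at each non-sink vertex. For any two acyclic rotor configurations $\rho$ and $\rho'$ on $G$, there exists a chip configuration $\sigma$ on $G$ such that $\sigma(\rho)=\rho'$.
   Context: Directed graphs are finite; self-loops and multiple edges are allowed. A sink is a vertex of out-degree zero; a global sink is a sink $s$ such that from every other vertex there is a directed path leading to $s$. A chip configuration is a vector $\sigma$ of non-negative integers indexed by the non-sink vertices. For each non-sink vertex $v$ a cyclic ordering of the edges emanating from $v$ is fixed, and $e^+$ denotes the edge following $e$ in it. A rotor configuration is a function $\rho$ assigning to each non-sink vertex $v$ an edge $\rho(v)$ emanating from $v$. It is acyclic if the edges $\rho(v)$ do not form any directed cycle (equivalently, they form an oriented spanning tree rooted at the sink). Routing a chip at a non-sink vertex $v$ for one step means replacing $\rho(v)$ by $\rho(v)^+$ and then moving the chip to the head of $\rho(v)^+$. For a non-sink vertex $v$, the chip addition operator $E_v$ is the map on rotor configurations given by adding a chip at $v$ and routing it repeatedly until it reaches the sink (which always happens after finitely many steps). The operators $E_v$ commute. For a chip configuration $\sigma$ and a rotor configuration $\rho$, $\sigma(\rho)=\left(\prod_{v\neq s}E_v^{\sigma(v)}\right)\rho$ (composition of operators), i.e. the rotor configuration obtained by adding $\sigma(v)$ chips at each vertex $v$ and routing them all to the sink. *)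

theory Defs
  imports
    "Graph_Theory.Graph_Theory"
    "HOL-Combinatorics.Orbits"
    "HOL-Library.While_Combinator"
    "HOL-Library.FuncSet"
begin

definition sink :: "('a, 'b) pre_digraph \<Rightarrow> 'a \<Rightarrow> bool" where
  "sink G s \<longleftrightarrow> s \<in> verts G \<and> out_degree G s = 0"

definition global_sink :: "('a, 'b) pre_digraph \<Rightarrow> 'a \<Rightarrow> bool" where
  "global_sink G s \<longleftrightarrow> sink G s \<and> (\<forall>v \<in> verts G - {s}. v \<rightarrow>\<^sup>*\<^bsub>G\<^esub> s)"

text \<open>
  When \<open>s\<close> is a global sink, every other vertex has positive out-degree, so the non-sink
  vertices are exactly the members of \<open>verts G - {s}\<close>.
  Configurations are extensional functions on this set, so that equality of functions is
  equality of configurations.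
\<close>

definition chip_configs :: "('a, 'b) pre_digraph \<Rightarrow> 'a \<Rightarrow> ('a \<Rightarrow> nat) set" where
  "chip_configs G s = (\<Pi>\<^sub>E v \<in> verts G - {s}. UNIV)"

definition rotor_configs :: "('a, 'b) pre_digraph \<Rightarrow> 'a \<Rightarrow> ('a \<Rightarrow> 'b) set" where
  "rotor_configs G s = (\<Pi>\<^sub>E v \<in> verts G - {s}. out_arcs G v)"

text \<open>
  A single function \<open>nxt\<close> encodes the cyclic orderings at all vertices: \<open>nxt e\<close> is the edge
  following \<open>e\<close> among the edges with the same tail.  The values of \<open>nxt\<close> outside the edges
  of \<open>G\<close> are irrelevant.
\<close>

definition rotor_ordering ::
  "('a, 'b) pre_digraph \<Rightarrow> 'a \<Rightarrow> ('b \<Rightarrow> 'b) \<Rightarrow> bool" where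
  "rotor_ordering G s nxt \<longleftrightarrow> (\<forall>v \<in> verts G - {s}. cyclic_on nxt (out_arcs G v))"

definition acyclic_rotor :: "('a, 'b) pre_digraph \<Rightarrow> 'a \<Rightarrow> ('a \<Rightarrow> 'b) \<Rightarrow> bool" where
  "acyclic_rotor G s \<rho> \<longleftrightarrow>
     \<not> (\<exists>p. pre_digraph.cycle G p \<and> set p \<subseteq> \<rho> ` (verts G - {s}))"

text \<open>The state of the routing process is the rotor configuration and the chip's position.\<close>

definition route_step ::
  "('a, 'b) pre_digraph \<Rightarrow> ('b \<Rightarrow> 'b) \<Rightarrow> ('a \<Rightarrow> 'b) \<times> 'a \<Rightarrow> ('a \<Rightarrow> 'b) \<times> 'a" where
  "route_step G nxt = (\<lambda>(\<rho>, v). (\<rho>(v := nxt (\<rho> v)), head G (nxt (\<rho> v))))"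

text \<open>
  The chip addition operator is a map on rotor configurations only.  It is extended by the
  identity to all other functions, so that the operators commute as total functions and
  their product below does not depend on the order of composition.
\<close>

definition chip_add ::
  "('a, 'b) pre_digraph \<Rightarrow> 'a \<Rightarrow> ('b \<Rightarrow> 'b) \<Rightarrow> 'a \<Rightarrow> ('a \<Rightarrow> 'b) \<Rightarrow> ('a \<Rightarrow> 'b)" where
  "chip_add G s nxt v \<rho> =
     (if \<rho> \<in> rotor_configs G s
      then fst (while (\<lambda>(_, u). u \<noteq> s) (route_step G nxt) (\<rho>, v))
      else \<rho>)"

definition chip_action ::
  "('a, 'b) pre_digraph \<Rightarrow> 'a \<Rightarrow> ('b \<Rightarrow> 'b) \<Rightarrow> ('a \<Rightarrow> nat) \<Rightarrow> ('a \<Rightarrow> 'b) \<Rightarrow> ('a \<Rightarrow> 'b)" where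
  "chip_action G s nxt \<sigma> \<rho> =
     Finite_Set.fold (\<lambda>v. chip_add G s nxt v ^^ \<sigma> v) \<rho> (verts G - {s})"

end

theory Submission
  imports Defs
begin

text \<open>
  For a rotor configuration \<open>\<rho>\<close> and a chip configuration \<open>c\<close>, say that \<open>u\<close> stabilises \<open>c\<close> if
  firing each vertex \<open>v\<close> exactly \<open>u v\<close> times leaves at most zero chips, where vertices may go
  into debt.  The arrivals at a vertex are monotone in \<open>u\<close>, and the numbers of firings in the
  actual routing process form the least stabilising \<open>u\<close>; this gives the commutativity of the
  operators \<open>E\<^sub>v\<close>.

  Suppose that firing according to \<open>w\<close> leaves exactly zero chips and an acyclic rotor configuration
  \<open>\<rho>'\<close>, and let \<open>u\<close> be least.  Then \<open>w - u\<close> leads from zero chips to zero chips, so no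
  chip goes to the sink, and a vertex with \<open>w v > u v\<close> sends a chip along \<open>\<rho>' v\<close> to another such
  vertex.  Following \<open>\<rho>'\<close> would yield a cycle, so \<open>u = w\<close> and the actual routing ends in \<open>\<rho>'\<close>.

  To find such a \<open>w\<close>, route a large number \<open>N\<close> of chips from every vertex to the sink, and then
  turn the rotors further to \<open>\<rho>'\<close>.  The latter takes a bounded number of steps, so that each
  vertex loses at least as many chips as it receives in total; the differences are the required
  chip configuration.
\<close>

locale rotor_router = fin_digraph G for G :: "('a, 'b) pre_digraph" (structure) +
  fixes s :: 'a and nxt :: "'b \<Rightarrow> 'b"
  assumes global_sink: "global_sink G s"
    and rotor_ordering: "rotor_ordering G s nxt"
begin

abbreviation V :: "'a set" where "V \<equiv> verts G - {s}"

section \<open>Firing vectors: turned rotors and arriving chips\<close>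

definition turn :: "('a \<Rightarrow> 'b) \<Rightarrow> ('a \<Rightarrow> nat) \<Rightarrow> 'a \<Rightarrow> 'b" where
  "turn \<rho> u v = (if v \<in> V then (nxt ^^ u v) (\<rho> v) else \<rho> v)"

text \<open>A rotor advances before the chip leaves along it, so the firing with index
  \<open>i\<close> uses the edge \<open>Suc i\<close> places after \<open>\<rho> v\<close>.\<close>

definition arrivals :: "('a \<Rightarrow> 'b) \<Rightarrow> ('a \<Rightarrow> nat) \<Rightarrow> 'a \<Rightarrow> nat" where
  "arrivals \<rho> u x = (\<Sum>v\<in>V. \<Sum>i<u v. of_bool (head G ((nxt ^^ Suc i) (\<rho> v)) = x))"

text \<open>The least pre-fixed point of the monotone map sending \<open>u\<close> to
  \<open>c\<close> plus arrivals. The competitors \<open>w\<close> may leave debt; this wider class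
  is what lets odometers be composed. Only values on \<open>V\<close> are constrained.\<close>

definition odometer :: "('a \<Rightarrow> 'b) \<Rightarrow> ('a \<Rightarrow> nat) \<Rightarrow> ('a \<Rightarrow> nat) \<Rightarrow> bool" where
  "odometer \<rho> c u \<longleftrightarrow> (\<forall>x\<in>V. c x + arrivals \<rho> u x = u x) \<and>
     (\<forall>w. (\<forall>x\<in>V. c x + arrivals \<rho> w x \<le> w x) \<longrightarrow> (\<forall>x\<in>V. u x \<le> w x))"

lemma finite_V: "finite V"
  by simp

lemma sink_in_verts: "s \<in> verts G"
  using global_sink by (simp add: global_sink_def sink_def)

lemma cyclic: "v \<in> V \<Longrightarrow> cyclic_on nxt (out_arcs G v)"
  using rotor_ordering by (simp add: rotor_ordering_def)

lemma rotor_in_out_arcs: "\<rho> \<in> rotor_configs G s \<Longrightarrow> v \<in> V \<Longrightarrow> \<rho> v \<in> out_arcs G v"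
  by (auto simp: rotor_configs_def PiE_iff)

lemma funpow_in_out_arcs:
  "\<rho> \<in> rotor_configs G s \<Longrightarrow> v \<in> V \<Longrightarrow> (nxt ^^ n) (\<rho> v) \<in> out_arcs G v"
  using cyclic_on_funpow_in cyclic rotor_in_out_arcs by metis

lemma head_funpow_in_verts:
  "\<rho> \<in> rotor_configs G s \<Longrightarrow> v \<in> V \<Longrightarrow> head G ((nxt ^^ n) (\<rho> v)) \<in> verts G"
  using funpow_in_out_arcs by (metis head_in_verts in_out_arcs_conv)

lemma turn_in_rotor_configs: "\<rho> \<in> rotor_configs G s \<Longrightarrow> turn \<rho> u \<in> rotor_configs G s"
  using funpow_in_out_arcs by (auto simp: rotor_configs_def PiE_iff turn_def extensional_def)

lemma turn_cong: "(\<And>v. v \<in> V \<Longrightarrow> u v = w v) \<Longrightarrow> turn \<rho> u = turn \<rho> w"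
  by (auto simp: turn_def)

lemma turn_add: "turn (turn \<rho> u) w = turn \<rho> (\<lambda>v. u v + w v)"
  by (auto simp: turn_def fun_eq_iff funpow_add add.commute[of "u _"])

lemma arrivals_mono:
  assumes "\<And>v. v \<in> V \<Longrightarrow> u v \<le> w v"
  shows "arrivals \<rho> u x \<le> arrivals \<rho> w x"
  unfolding arrivals_def using assms by (intro sum_mono sum_mono2) auto

lemma arrivals_cong: "(\<And>v. v \<in> V \<Longrightarrow> u v = w v) \<Longrightarrow> arrivals \<rho> u x = arrivals \<rho> w x"
  by (auto simp: arrivals_def intro: sum.cong)

text \<open>The firings counted by \<open>w\<close> start where \<open>u\<close> has left the
  rotors, so each inner sum splits at \<open>u v\<close>.\<close>

lemma arrivals_add:
  "arrivals \<rho> (\<lambda>v. u v + w v) x = arrivals \<rho> u x + arrivals (turn \<rho> u) w x"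
proof -
  have split: "sum f {..<a + b} = sum f {..<a} + (\<Sum>i<b. f (a + i))" for f :: "nat \<Rightarrow> nat" and a b
    by (induction b) auto
  have "(nxt ^^ Suc (u v + i)) (\<rho> v) = (nxt ^^ Suc i) (turn \<rho> u v)" if "v \<in> V" for v i
    using that by (simp add: turn_def funpow_add flip: add.commute[of i "u v"])
  then show ?thesis
    unfolding arrivals_def split sum.distrib by (intro arg_cong2[of _ _ _ _ "(+)"] sum.cong) auto
qed

lemma arrivals_single:
  assumes "y \<in> V"
  shows "arrivals \<rho> (\<lambda>v. of_bool (v = y)) x = of_bool (head G (nxt (\<rho> y)) = x)"
proof -
  have "arrivals \<rho> (\<lambda>v. of_bool (v = y)) x
      = (\<Sum>v\<in>V. if v = y then of_bool (head G (nxt (\<rho> y)) = x) else 0)"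
    unfolding arrivals_def by (intro sum.cong) (auto simp: lessThan_Suc simp del: sum_of_bool_eq)
  then show ?thesis using assms by (simp add: sum.delta)
qed

lemma arrivals_diff:
  assumes "\<And>v. v \<in> V \<Longrightarrow> u v \<le> w v"
  shows "arrivals \<rho> w x = arrivals \<rho> u x + arrivals (turn \<rho> u) (\<lambda>v. w v - u v) x"
    and "turn (turn \<rho> u) (\<lambda>v. w v - u v) = turn \<rho> w"
  unfolding arrivals_add[symmetric] turn_add
  by (rule arrivals_cong turn_cong; simp add: assms)+

text \<open>Conservation of chips: each firing delivers one chip to exactly one vertex, possibly the
  sink.\<close>

lemma sum_arrivals:
  assumes "\<rho> \<in> rotor_configs G s"
  shows "(\<Sum>x\<in>V. arrivals \<rho> u x) + arrivals \<rho> u s = (\<Sum>v\<in>V. u v)"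
proof -
  have "(\<Sum>x\<in>V. arrivals \<rho> u x) + arrivals \<rho> u s = (\<Sum>x\<in>verts G. arrivals \<rho> u x)"
    using sink_in_verts by (simp add: sum.remove add.commute)
  also have "\<dots> = (\<Sum>v\<in>V. \<Sum>i<u v. \<Sum>x\<in>verts G. of_bool (head G ((nxt ^^ Suc i) (\<rho> v)) = x))"
    unfolding arrivals_def by (subst sum.swap) (intro sum.cong refl sum.swap)
  also have "\<dots> = (\<Sum>v\<in>V. \<Sum>i<u v. 1)"
  proof (intro sum.cong refl)
    fix v i assume "v \<in> V"
    then have "head G ((nxt ^^ Suc i) (\<rho> v)) \<in> verts G"
      using assms head_funpow_in_verts by blast
    then show "(\<Sum>x\<in>verts G. of_bool (head G ((nxt ^^ Suc i) (\<rho> v)) = x)) = (1::nat)"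
      by (simp add: of_bool_def)
  qed
  finally show ?thesis by simp
qed

lemma arrivals_ge_visits:
  assumes "v \<in> V"
  shows "(\<Sum>i<u v. of_bool (head G ((nxt ^^ Suc i) (\<rho> v)) = x)) \<le> arrivals \<rho> u x"
  unfolding arrivals_def
  by (rule member_le_sum[OF assms]) simp_all

section \<open>Additivity of odometers\<close>

lemma odometer_fixed: "odometer \<rho> c u \<Longrightarrow> x \<in> V \<Longrightarrow> c x + arrivals \<rho> u x = u x"
  by (simp add: odometer_def)

lemma odometer_least:
  assumes "odometer \<rho> c u" and "\<And>x. x \<in> V \<Longrightarrow> c x + arrivals \<rho> w x \<le> w x" and "x \<in> V"
  shows "u x \<le> w x"
  using assms by (simp add: odometer_def)

lemma odometer_cong:
  assumes "odometer \<rho> c u" and "\<And>v. v \<in> V \<Longrightarrow> c v = c' v"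
  shows "odometer \<rho> c' u"
  using assms by (auto simp: odometer_def)

lemma odometer_turn_unique:
  assumes "odometer \<rho> c u" and "odometer \<rho> c w"
  shows "turn \<rho> u = turn \<rho> w"
  using assms by (intro turn_cong order_antisym) (auto simp: odometer_def)

text \<open>A vector \<open>z\<close> that stabilises \<open>c + d\<close> also stabilises
  \<open>c\<close>, so it dominates \<open>u\<close>. The remainder \<open>z - u\<close> then
  stabilises \<open>d\<close> from the turned rotors, so it dominates \<open>w\<close>.\<close>

lemma odometer_add:
  assumes u: "odometer \<rho> c u" and w: "odometer (turn \<rho> u) d w"
  shows "odometer \<rho> (\<lambda>v. c v + d v) (\<lambda>v. u v + w v)"
proof -
  have eq: "c x + d x + arrivals \<rho> (\<lambda>v. u v + w v) x = u x + w x" if "x \<in> V" for x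
    using odometer_fixed[OF u that] odometer_fixed[OF w that] by (simp add: arrivals_add)
  have "u x + w x \<le> z x"
    if z: "\<forall>x\<in>V. c x + d x + arrivals \<rho> z x \<le> z x" and x: "x \<in> V" for z x
  proof -
    have "c x + arrivals \<rho> z x \<le> z x" if "x \<in> V" for x
      using bspec[OF z that] by simp
    then have le: "\<forall>x\<in>V. u x \<le> z x"
      using odometer_least[OF u] by blast
    have "d x + arrivals (turn \<rho> u) (\<lambda>v. z v - u v) x \<le> z x - u x" if "x \<in> V" for x
    proof -
      have "c x + d x + arrivals \<rho> z x \<le> z x" "c x + arrivals \<rho> u x = u x"
        using z u that by (auto simp: odometer_def)
      with arrivals_diff(1)[of u z \<rho> x] le show ?thesis by auto
    qed
    then have "w x \<le> z x - u x"
      using odometer_least[OF w _ x] by blast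
    then show ?thesis using bspec[OF le x] by linarith
  qed
  with eq show ?thesis by (simp add: odometer_def)
qed

section \<open>Existence of odometers\<close>

text \<open>By cyclicity the rotor at \<open>v\<close> returns to \<open>e\<close> after any given
  time, so each edge is used arbitrarily often.\<close>

lemma visits_unbounded:
  assumes "\<rho> \<in> rotor_configs G s" "v \<in> V" "e \<in> out_arcs G v"
  shows "\<exists>M. (\<Sum>i<M. of_bool (head G ((nxt ^^ Suc i) (\<rho> v)) = head G e)) > (B::nat)"
proof -
  have visit: "\<exists>k\<ge>n. (nxt ^^ Suc k) (\<rho> v) = e" for n
  proof -
    have "(nxt ^^ n) (\<rho> v) \<in> out_arcs G v"
      using funpow_in_out_arcs assms by blast
    then have "e \<in> orbit nxt ((nxt ^^ n) (\<rho> v))"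
      using cyclic[OF \<open>v \<in> V\<close>] assms(3) by (simp add: orbit_cyclic_eq3)
    then obtain m where "0 < m" "e = (nxt ^^ m) ((nxt ^^ n) (\<rho> v))"
      unfolding orbit_altdef by auto
    then have "(nxt ^^ Suc (m - 1 + n)) (\<rho> v) = e"
      by (metis Suc_pred' add_Suc comp_apply diff_Suc_1 funpow_add Suc_diff_1)
    then show ?thesis using le_add2 by blast
  qed
  show ?thesis
  proof (induction B)
    case 0
    obtain k where "(nxt ^^ Suc k) (\<rho> v) = e" using visit by blast
    then show ?case by (intro exI[of _ "Suc k"]) auto
  next
    case (Suc B)
    then obtain M where M: "(\<Sum>i<M. of_bool (head G ((nxt ^^ Suc i) (\<rho> v)) = head G e)) > B"
      by blast
    obtain k where k: "k \<ge> M" "(nxt ^^ Suc k) (\<rho> v) = e" using visit by blast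
    have "B < (\<Sum>i<k. of_bool (head G ((nxt ^^ Suc i) (\<rho> v)) = head G e))"
      using M by (rule less_le_trans) (rule sum_mono2, use k in auto)
    then show ?case using k(2) by (intro exI[of _ "Suc k"]) auto
  qed
qed

text \<open>Iterating the monotone map \<open>F\<close> from zero gives an increasing sequence. It
  is bounded on \<open>V\<close>, hence becomes constant there, and its limit is the least pre-fixed
  point.\<close>

lemma odometer_exists:
  assumes rho: "\<rho> \<in> rotor_configs G s"
  shows "\<exists>u. odometer \<rho> c u"
proof -
  define F where "F u x = c x + arrivals \<rho> u x" for u x
  define U where "U k = (F ^^ k) (\<lambda>_. 0)" for k
  have U_Suc: "U (Suc k) x = c x + arrivals \<rho> (U k) x" for k x
    by (simp add: U_def F_def)
  have inc: "U k x \<le> U (Suc k) x" for k x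
  proof (induction k arbitrary: x)
    case 0 then show ?case by (simp add: U_def)
  next
    case (Suc k) then show ?case
      unfolding U_Suc[of "Suc k"] U_Suc[of k] by (intro add_left_mono arrivals_mono)
  qed
  \<comment> \<open>The total of \<open>U k\<close> is at most that of \<open>U (Suc k)\<close>;
    expanding both by conservation cancels the arrivals inside \<open>V\<close>.\<close>
  have sink_bound: "arrivals \<rho> (U k) s \<le> (\<Sum>x\<in>V. c x)" for k
  proof -
    have "(\<Sum>x\<in>V. U k x) \<le> (\<Sum>x\<in>V. U (Suc k) x)"
      by (intro sum_mono inc)
    with sum_arrivals[OF rho, of "U k"] show ?thesis
      by (simp add: U_Suc sum.distrib)
  qed
  \<comment> \<open>Boundedness spreads backwards along paths to the sink: if few chips arrive at
    \<open>x\<close>, a vertex with an edge to \<open>x\<close> cannot fire often.\<close>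
  have bound_V: "\<exists>B. \<forall>k. U k v \<le> B" if "v \<rightarrow>\<^sup>*\<^bsub>G\<^esub> s" "v \<noteq> s" for v
    using that
  proof (induction rule: converse_reachable_induct)
    case base then show ?case by simp
  next
    case (step v x)
    have "\<exists>B. \<forall>k. arrivals \<rho> (U k) x \<le> B"
    proof (cases "x = s")
      case True then show ?thesis using sink_bound by blast
    next
      case False
      then obtain B where "\<forall>k. U k x \<le> B" using step.IH by blast
      then have "arrivals \<rho> (U k) x \<le> B" for k
        by (metis U_Suc add_leE)
      then show ?thesis by blast
    qed
    then obtain B where B: "\<And>k. arrivals \<rho> (U k) x \<le> B" by blast
    obtain e where e: "e \<in> out_arcs G v" "head G e = x"
      using step.hyps(1) by (auto elim: reachableE)
    have v: "v \<in> V" using step.prems e by auto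
    obtain M where M: "(\<Sum>i<M. of_bool (head G ((nxt ^^ Suc i) (\<rho> v)) = x)) > B"
      using visits_unbounded[OF rho v e(1)] e(2) by blast
    have "U k v \<le> M" for k
    proof (rule ccontr)
      assume "\<not> U k v \<le> M"
      then have "(\<Sum>i<M. of_bool (head G ((nxt ^^ Suc i) (\<rho> v)) = x))
          \<le> (\<Sum>i<U k v. of_bool (head G ((nxt ^^ Suc i) (\<rho> v)) = x) :: nat)"
        by (intro sum_mono2) auto
      with M arrivals_ge_visits[OF v, where u = "U k"] B[of k] show False
        by (meson leD le_trans)
    qed
    then show ?case by blast
  qed
  have "\<exists>B. \<forall>k. U k v \<le> B" if "v \<in> V" for v
    using bound_V that global_sink by (auto simp: global_sink_def)
  then obtain B where B: "\<And>v k. v \<in> V \<Longrightarrow> U k v \<le> B v" by metis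
  have "(\<Sum>v\<in>V. U k v) \<le> (\<Sum>v\<in>V. B v)" for k
    by (intro sum_mono B)
  \<comment> \<open>At an index of maximal total no component can still grow, as all of them are
    nondecreasing.\<close>
  then obtain k where k: "\<And>j. (\<Sum>v\<in>V. U j v) \<le> (\<Sum>v\<in>V. U k v)"
    using ex_has_greatest_nat[of "\<lambda>_. True" 0 "\<lambda>k. \<Sum>v\<in>V. U k v" "Suc (\<Sum>v\<in>V. B v)"]
    by (auto simp: less_Suc_eq_le)
  have "U (Suc k) x = U k x" if "x \<in> V" for x
  proof (rule ccontr)
    assume "U (Suc k) x \<noteq> U k x"
    then have "U k x < U (Suc k) x"
      using inc[of k x] by simp
    then have "(\<Sum>v\<in>V. U k v) < (\<Sum>v\<in>V. U (Suc k) v)"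
      using that by (intro sum_strict_mono_ex1 finite_V ballI inc bexI)
    with k[of "Suc k"] show False by simp
  qed
  \<comment> \<open>Iterates that start at zero stay below every pre-fixed point.\<close>
  moreover have "U k x \<le> w x" if w: "\<forall>x\<in>V. c x + arrivals \<rho> w x \<le> w x" and "x \<in> V" for k w x
    using that(2)
  proof (induction k arbitrary: x)
    case 0 then show ?case by (simp add: U_def)
  next
    case (Suc k)
    then have "arrivals \<rho> (U k) x \<le> arrivals \<rho> w x"
      by (intro arrivals_mono)
    moreover have "c x + arrivals \<rho> w x \<le> w x"
      using w Suc.prems by (rule bspec)
    ultimately show ?case by (simp add: U_Suc)
  qed
  ultimately show ?thesis
    unfolding odometer_def U_Suc by blast
qed

section \<open>The routing process computes odometers\<close>

text \<open>Loop invariant: \<open>u\<close> counts the firings so far, and the only unprocessed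
  chip is at \<open>y\<close>; on \<open>V\<close> this surplus vanishes once \<open>y = s\<close>.
  The measure is the number of firings still missing from \<open>w\<close>, so termination comes
  with the result.\<close>

lemma while_route_step:
  assumes rho: "\<rho> \<in> rotor_configs G s"
    and w: "odometer \<rho> c w"
    and le: "\<And>x. x \<in> V \<Longrightarrow> u x \<le> w x"
    and pos: "y \<in> verts G"
    and bal: "\<And>x. x \<in> V \<Longrightarrow> c x + arrivals \<rho> u x = u x + of_bool (x = y)"
  shows "fst (while (\<lambda>(_, z). z \<noteq> s) (route_step G nxt) (turn \<rho> u, y)) = turn \<rho> w"
  using le pos bal
proof (induction "\<Sum>x\<in>V. w x - u x" arbitrary: u y rule: less_induct)
  case less
  show ?case
  proof (cases "y = s")
    case True
    \<comment> \<open>With the chip in the sink, \<open>u\<close> itself stabilises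
      \<open>c\<close>, and minimality of \<open>w\<close> applies.\<close>
    then have "w x \<le> u x" if "x \<in> V" for x
      using odometer_least[OF w _ that] less.prems(3) by fastforce
    then have "turn \<rho> u = turn \<rho> w"
      using less.prems(1) by (intro turn_cong order_antisym) auto
    then show ?thesis using True by (subst while_unfold) simp
  next
    case False
    then have y: "y \<in> V" using less.prems(2) by simp
    define a where "a = (nxt ^^ Suc (u y)) (\<rho> y)"
    define u' where "u' = u(y := Suc (u y))"
    \<comment> \<open>The surplus chip at \<open>y\<close> shows that one more firing there does not
      exceed \<open>w\<close>.\<close>
    have "Suc (u y) = c y + arrivals \<rho> u y"
      using less.prems(3) y by simp
    also have "\<dots> \<le> c y + arrivals \<rho> w y"
      using less.prems(1) by (intro add_left_mono arrivals_mono)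
    also have "\<dots> = w y"
      using w y by (simp add: odometer_def)
    finally have uw: "Suc (u y) \<le> w y" .
    then have le': "\<And>x. x \<in> V \<Longrightarrow> u' x \<le> w x"
      using less.prems(1) by (simp add: u'_def)
    have arr: "arrivals \<rho> u' x = arrivals \<rho> u x + of_bool (head G a = x)" for x
    proof -
      have "arrivals \<rho> u' x = arrivals \<rho> (\<lambda>v. u v + of_bool (v = y)) x"
        by (rule arrivals_cong) (simp add: u'_def)
      also have "\<dots> = arrivals \<rho> u x + of_bool (head G (nxt (turn \<rho> u y)) = x)"
        using y by (simp only: arrivals_add arrivals_single)
      also have "nxt (turn \<rho> u y) = a"
        using y by (simp add: turn_def a_def)
      finally show ?thesis .
    qed
    have step: "route_step G nxt (turn \<rho> u, y) = (turn \<rho> u', head G a)"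
      using y by (auto simp: route_step_def turn_def u'_def a_def fun_eq_iff)
    have dec: "(\<Sum>x\<in>V. w x - u' x) < (\<Sum>x\<in>V. w x - u x)"
      using y uw by (intro sum_strict_mono_ex1) (auto simp: u'_def intro!: bexI[of _ y])
    have a: "head G a \<in> verts G"
      unfolding a_def using rho y by (rule head_funpow_in_verts)
    have "c x + arrivals \<rho> u' x = u' x + of_bool (x = head G a)" if "x \<in> V" for x
      using less.prems(3)[OF that] unfolding arr by (auto simp: u'_def)
    from less.hyps[OF dec le' a this] show ?thesis
      using False by (subst while_unfold) (simp add: step)
  qed
qed

lemma chip_add_odometer:
  assumes "\<rho> \<in> rotor_configs G s" and "v \<in> V"
  shows "\<exists>u. odometer \<rho> (\<lambda>x. of_bool (x = v)) u \<and> chip_add G s nxt v \<rho> = turn \<rho> u"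
proof -
  obtain w where w: "odometer \<rho> (\<lambda>x. of_bool (x = v)) w"
    using odometer_exists[OF assms(1)] by blast
  have "fst (while (\<lambda>(_, z). z \<noteq> s) (route_step G nxt) (turn \<rho> (\<lambda>_. 0), v)) = turn \<rho> w"
    using assms by (intro while_route_step[OF _ w]) (auto simp: arrivals_def)
  moreover have "turn \<rho> (\<lambda>_. 0) = \<rho>"
    by (simp add: turn_def fun_eq_iff)
  ultimately show ?thesis
    using w assms(1) by (auto simp: chip_add_def)
qed

text \<open>Both orders turn the rotors by an odometer of the same two chips.\<close>

lemma chip_add_commute:
  assumes "v \<in> V" and "w \<in> V"
  shows "chip_add G s nxt w (chip_add G s nxt v \<rho>) = chip_add G s nxt v (chip_add G s nxt w \<rho>)"
proof (cases "\<rho> \<in> rotor_configs G s")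
  case True
  have two: "\<exists>u. odometer \<rho> (\<lambda>x. of_bool (x = v) + of_bool (x = w)) u
      \<and> chip_add G s nxt w (chip_add G s nxt v \<rho>) = turn \<rho> u"
    if v: "v \<in> V" and w: "w \<in> V" for v w
  proof -
    obtain u where u: "odometer \<rho> (\<lambda>x. of_bool (x = v)) u" "chip_add G s nxt v \<rho> = turn \<rho> u"
      using chip_add_odometer[OF True v] by blast
    obtain u' where u': "odometer (turn \<rho> u) (\<lambda>x. of_bool (x = w)) u'"
        "chip_add G s nxt w (turn \<rho> u) = turn (turn \<rho> u) u'"
      using chip_add_odometer[OF turn_in_rotor_configs[OF True] w] by blast
    from odometer_add[OF u(1) u'(1)] u(2) u'(2) show ?thesis
      by (auto simp: turn_add)
  qed
  show ?thesis
    using two[OF assms] two[OF assms(2,1)] odometer_turn_unique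
    by (metis (no_types, lifting) add.commute odometer_cong)
next
  \<comment> \<open>\<open>comp_fun_commute_on\<close> asks for equality of total functions; here
    \<open>chip_add\<close> is the identity.\<close>
  case False then show ?thesis by (simp add: chip_add_def)
qed

lemma chip_add_funpow_odometer:
  assumes "\<rho> \<in> rotor_configs G s" and "v \<in> V"
  shows "\<exists>u. odometer \<rho> (\<lambda>x. if x = v then n else 0) u
    \<and> (chip_add G s nxt v ^^ n) \<rho> = turn \<rho> u"
proof (induction n)
  case 0
  have "odometer \<rho> (\<lambda>x. if x = v then 0 else 0) (\<lambda>_. 0)"
    by (simp add: odometer_def arrivals_def)
  moreover have "turn \<rho> (\<lambda>_. 0) = \<rho>"
    by (simp add: turn_def fun_eq_iff)
  ultimately show ?case by force
next
  case (Suc n)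
  then obtain u where u: "odometer \<rho> (\<lambda>x. if x = v then n else 0) u"
      "(chip_add G s nxt v ^^ n) \<rho> = turn \<rho> u"
    by blast
  obtain u' where u': "odometer (turn \<rho> u) (\<lambda>x. of_bool (x = v)) u'"
      "chip_add G s nxt v (turn \<rho> u) = turn (turn \<rho> u) u'"
    using chip_add_odometer[OF turn_in_rotor_configs[OF assms(1)] assms(2)] by blast
  have "odometer \<rho> (\<lambda>x. if x = v then Suc n else 0) (\<lambda>v. u v + u' v)"
    using odometer_add[OF u(1) u'(1)] by (rule odometer_cong) auto
  then show ?case using u(2) u'(2) by (auto simp: turn_add)
qed

lemma chip_action_odometer:
  assumes rho: "\<rho> \<in> rotor_configs G s"
  shows "\<exists>u. odometer \<rho> \<sigma> u \<and> chip_action G s nxt \<sigma> \<rho> = turn \<rho> u"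
proof -
  interpret comp_fun_commute_on V "chip_add G s nxt"
    by standard (auto simp: fun_eq_iff chip_add_commute)
  interpret P: comp_fun_commute_on V "\<lambda>v. chip_add G s nxt v ^^ \<sigma> v"
    by (rule comp_fun_commute_on_funpow)
  \<comment> \<open>For the induction along the fold, only the chips on the subset \<open>A\<close>
    are added.\<close>
  have "\<exists>u. odometer \<rho> (\<lambda>x. if x \<in> A then \<sigma> x else 0) u
      \<and> Finite_Set.fold (\<lambda>v. chip_add G s nxt v ^^ \<sigma> v) \<rho> A = turn \<rho> u" if "A \<subseteq> V" for A
    using finite_subset[OF that finite_V] that
  proof (induction A rule: finite_induct)
    case empty
    have "odometer \<rho> (\<lambda>_. 0) (\<lambda>_. 0)" by (simp add: odometer_def arrivals_def)
    moreover have "turn \<rho> (\<lambda>_. 0) = \<rho>" by (simp add: turn_def fun_eq_iff)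
    ultimately show ?case by force
  next
    case (insert v A)
    then obtain u where u: "odometer \<rho> (\<lambda>x. if x \<in> A then \<sigma> x else 0) u"
        "Finite_Set.fold (\<lambda>v. chip_add G s nxt v ^^ \<sigma> v) \<rho> A = turn \<rho> u"
      by auto
    obtain u' where u': "odometer (turn \<rho> u) (\<lambda>x. if x = v then \<sigma> v else 0) u'"
        "(chip_add G s nxt v ^^ \<sigma> v) (turn \<rho> u) = turn (turn \<rho> u) u'"
      using chip_add_funpow_odometer[OF turn_in_rotor_configs[OF rho], of v] insert.prems by blast
    have "odometer \<rho> (\<lambda>x. if x \<in> insert v A then \<sigma> x else 0) (\<lambda>v. u v + u' v)"
      using odometer_add[OF u(1) u'(1)] by (rule odometer_cong) (use insert.hyps in auto)
    moreover have "Finite_Set.fold (\<lambda>v. chip_add G s nxt v ^^ \<sigma> v) \<rho> (insert v A)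
        = turn \<rho> (\<lambda>v. u v + u' v)"
      using P.fold_insert[OF insert.prems insert.hyps] u(2) u'(2) by (simp add: turn_add)
    ultimately show ?case by blast
  qed
  from this[of V] obtain u where "odometer \<rho> (\<lambda>x. if x \<in> V then \<sigma> x else 0) u"
      "chip_action G s nxt \<sigma> \<rho> = turn \<rho> u"
    unfolding chip_action_def by blast
  moreover from this(1) have "odometer \<rho> \<sigma> u" by (rule odometer_cong) simp
  ultimately show ?thesis by blast
qed

section \<open>Acyclic rotors certify minimality\<close>

text \<open>Following the rotors from a vertex of the finite set \<open>Z\<close> must revisit a
  vertex, which gives a closed walk.\<close>

lemma closed_rotor_set_cycle:
  assumes rho: "\<rho> \<in> rotor_configs G s"
    and Z: "Z \<subseteq> V" "Z \<noteq> {}" "\<And>v. v \<in> Z \<Longrightarrow> head G (\<rho> v) \<in> Z"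
  shows "\<not> acyclic_rotor G s \<rho>"
proof -
  \<comment> \<open>In this subgraph the only arcs are rotors of \<open>Z\<close>, so the cycle
    extracted from the closed walk also consists of rotors.\<close>
  define H where "H = G\<lparr>arcs := \<rho> ` Z\<rparr>"
  have rho_arc: "\<rho> v \<in> arcs G" "tail G (\<rho> v) = v" if "v \<in> Z" for v
    using rotor_in_out_arcs[OF rho, of v] that Z(1) by auto
  interpret H: wf_digraph H
    using Z rho_arc by unfold_locales (auto simp: H_def)
  have sub: "subgraph H G"
    using rho_arc by (auto simp: subgraph_def H_def compatible_def H.wf_digraph[unfolded H_def] wf_digraph)
  define f where "f v = head G (\<rho> v)" for v
  obtain z where z: "z \<in> Z" using Z(2) by blast
  have orb: "(f ^^ n) v \<in> Z" if "v \<in> Z" for n v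
    using that by (induction n) (auto simp: f_def Z(3))
  have walk: "\<exists>p. H.awalk v p ((f ^^ n) v) \<and> length p = n" if "v \<in> Z" for n v
    using that
  proof (induction n arbitrary: v)
    case 0 then show ?case using Z(1) by (intro exI[of _ "[]"]) (simp add: H.awalk_Nil_iff, auto simp: H_def)
  next
    case (Suc n)
    then have "f v \<in> Z" by (simp add: f_def Z(3))
    then obtain p where p: "H.awalk (f v) p ((f ^^ n) (f v))" "length p = n"
      using Suc.IH by blast
    have "H.awalk v (\<rho> v # p) ((f ^^ Suc n) v)"
      using p(1) Suc.prems rho_arc
      by (simp add: H.awalk_Cons_iff funpow_swap1) (auto simp: H_def f_def)
    with p(2) show ?case by (metis length_Cons)
  qed
  have "finite Z" using Z(1) finite_V finite_subset by blast
  then have "finite (range (\<lambda>n. (f ^^ n) z))"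
    by (rule finite_subset[rotated]) (use orb z in auto)
  then have "\<not> inj (\<lambda>n. (f ^^ n) z)"
    using finite_imageD infinite_UNIV_nat by blast
  then obtain i j where ij: "i < j" "(f ^^ i) z = (f ^^ j) z"
    unfolding inj_def by (metis nat_neq_iff)
  then have "(f ^^ (j - i)) ((f ^^ i) z) = (f ^^ i) z"
    by (metis add.commute comp_apply funpow_add le_add_diff_inverse less_imp_le)
  with walk[OF orb[OF z, of i], of "j - i"] ij(1) have "\<exists>p. H.closed_w p"
    unfolding H.closed_w_def by (metis zero_less_diff)
  then obtain p where p: "H.cycle p" using H.closed_w_imp_cycle by blast
  then have "cycle p" by (rule subgraph_cycle[OF sub])
  moreover have "set p \<subseteq> \<rho> ` V"
  proof -
    have "set p \<subseteq> arcs H"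
      using p by (auto simp: H.cycle_def H.awalk_def)
    also have "\<dots> \<subseteq> \<rho> ` V"
      using Z(1) by (simp add: H_def image_mono)
    finally show ?thesis .
  qed
  ultimately show ?thesis by (auto simp: acyclic_rotor_def)
qed

text \<open>Acyclicity of the final rotors stands in for minimality of \<open>w\<close>: surplus
  firings beyond \<open>u\<close> would leave a cycle behind.\<close>

lemma odometer_acyclic:
  assumes rho: "\<rho> \<in> rotor_configs G s"
    and u: "odometer \<rho> c u"
    and w: "\<And>x. x \<in> V \<Longrightarrow> c x + arrivals \<rho> w x = w x"
    and acyc: "acyclic_rotor G s (turn \<rho> w)"
  shows "turn \<rho> u = turn \<rho> w"
proof -
  define \<tau> where "\<tau> = turn \<rho> u"
  define z where "z v = w v - u v" for v
  have le: "u x \<le> w x" if "x \<in> V" for x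
    using u w that by (simp add: odometer_def)
  have tau: "\<tau> \<in> rotor_configs G s"
    using turn_in_rotor_configs[OF rho] by (simp add: \<tau>_def)
  have turn_z: "turn \<tau> z = turn \<rho> w"
    unfolding \<tau>_def z_def using le by (rule arrivals_diff(2))
  \<comment> \<open>Neither \<open>u\<close> nor \<open>w\<close> leaves chips on \<open>V\<close>,
    so the surplus firings are balanced at each vertex.\<close>
  have z: "arrivals \<tau> z x = z x" if "x \<in> V" for x
  proof -
    have "arrivals \<rho> w x = arrivals \<rho> u x + arrivals \<tau> z x"
      unfolding \<tau>_def z_def using le by (rule arrivals_diff(1))
    with odometer_fixed[OF u that] w[OF that] show ?thesis
      by (simp add: z_def)
  qed
  have sink: "arrivals \<tau> z s = 0"
    using sum_arrivals[OF tau, of z] z by simp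
  define Z where "Z = {v \<in> V. z v > 0}"
  have "head G (turn \<tau> z v) \<in> Z" if "v \<in> Z" for v
  proof -
    have v: "v \<in> V" "z v > 0" using that by (auto simp: Z_def)
    define x where "x = head G (turn \<tau> z v)"
    \<comment> \<open>The last firing of \<open>v\<close>, with index \<open>z v - 1\<close>, goes
      along the final rotor.\<close>
    have x: "x = head G ((nxt ^^ Suc (z v - 1)) (\<tau> v))"
      using v by (simp add: x_def turn_def del: funpow.simps)
    then have "1 \<le> (\<Sum>i<z v. of_bool (head G ((nxt ^^ Suc i) (\<tau> v)) = x) :: nat)"
      using v member_le_sum[of "z v - 1" "{..<z v}"
          "\<lambda>i. of_bool (head G ((nxt ^^ Suc i) (\<tau> v)) = x) :: nat"]
      by simp
    also have "\<dots> \<le> arrivals \<tau> z x"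
      using v(1) by (rule arrivals_ge_visits)
    finally have "arrivals \<tau> z x > 0" by simp
    moreover have "x \<in> verts G"
      unfolding x using tau v(1) by (rule head_funpow_in_verts)
    ultimately show ?thesis
      using sink z[of x] by (cases "x = s") (auto simp: Z_def x_def)
  qed
  then have "Z = {}"
    using closed_rotor_set_cycle[of "turn \<tau> z" Z] acyc turn_z turn_in_rotor_configs[OF rho]
    by (auto simp: Z_def)
  then show ?thesis
    using le by (intro turn_cong order_antisym) (auto simp: Z_def z_def)
qed

section \<open>Construction of the chip configuration\<close>

lemma turn_transitive:
  assumes "\<tau> \<in> rotor_configs G s" and "\<rho>' \<in> rotor_configs G s"
  shows "turn \<tau> (\<lambda>v. funpow_dist nxt (\<tau> v) (\<rho>' v)) = \<rho>'"
proof
  fix v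
  show "turn \<tau> (\<lambda>v. funpow_dist nxt (\<tau> v) (\<rho>' v)) v = \<rho>' v"
  proof (cases "v \<in> V")
    case True
    then have "\<rho>' v \<in> orbit nxt (\<tau> v)"
      using orbit_cyclic_eq3[OF cyclic] rotor_in_out_arcs assms by metis
    then show ?thesis using True by (simp add: turn_def funpow_dist_prop)
  next
    case False
    then show ?thesis
      using assms by (auto simp: turn_def rotor_configs_def PiE_iff extensional_def)
  qed
qed

lemma chip_action_transitive:
  assumes rho: "\<rho> \<in> rotor_configs G s"
    and rho': "\<rho>' \<in> rotor_configs G s" "acyclic_rotor G s \<rho>'"
  shows "\<exists>\<sigma> \<in> chip_configs G s. chip_action G s nxt \<sigma> \<rho> = \<rho>'"
proof -
  \<comment> \<open>\<open>N\<close> has to be fixed before \<open>\<tau>\<close> is known, so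
    \<open>M\<close> bounds the distances between all pairs of edges. Pairs with different tails
    only enlarge it.\<close>
  define M where "M = (\<Sum>e\<in>arcs G. \<Sum>e'\<in>arcs G. funpow_dist nxt e e')"
  define N where "N = card V * M"
  have M: "funpow_dist nxt e e' \<le> M" if "e \<in> arcs G" "e' \<in> arcs G" for e e'
  proof -
    have "funpow_dist nxt e e' \<le> (\<Sum>e'\<in>arcs G. funpow_dist nxt e e')"
      using that by (intro member_le_sum) auto
    also have "\<dots> \<le> M"
      unfolding M_def using that(1) by (intro member_le_sum) auto
    finally show ?thesis .
  qed
  obtain u where u: "odometer \<rho> (\<lambda>_. N) u"
    using odometer_exists[OF rho] by blast
  define \<tau> where "\<tau> = turn \<rho> u"
  have tau: "\<tau> \<in> rotor_configs G s"
    unfolding \<tau>_def using rho by (rule turn_in_rotor_configs)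
  define a where "a v = funpow_dist nxt (\<tau> v) (\<rho>' v)" for v
  define w where "w v = u v + a v" for v
  have turn_w: "turn \<rho> w = \<rho>'"
    using turn_transitive[OF tau rho'(1)] turn_add[of \<rho> u a]
    by (simp flip: a_def w_def \<tau>_def)
  have a: "arrivals \<tau> a x \<le> N" if "x \<in> V" for x
  proof -
    have "arrivals \<tau> a x \<le> (\<Sum>x\<in>V. arrivals \<tau> a x)"
      using that by (intro member_le_sum) auto
    also have "\<dots> \<le> (\<Sum>v\<in>V. a v)"
      using sum_arrivals[OF tau, of a] by linarith
    also have "\<dots> \<le> (\<Sum>v\<in>V. M)"
    proof (rule sum_mono)
      fix v assume "v \<in> V"
      then have "\<tau> v \<in> arcs G" "\<rho>' v \<in> arcs G"
        using rotor_in_out_arcs[OF tau] rotor_in_out_arcs[OF rho'(1)] by auto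
      then show "a v \<le> M" unfolding a_def by (rule M)
    qed
    finally show ?thesis by (simp add: N_def)
  qed
  \<comment> \<open>The \<open>N\<close> chips initially at \<open>x\<close> outweigh the arrivals
    caused by the final turns \<open>a\<close>.\<close>
  have le: "arrivals \<rho> w x \<le> w x" if "x \<in> V" for x
  proof -
    have "arrivals \<rho> w x = arrivals \<rho> u x + arrivals \<tau> a x"
      unfolding w_def \<tau>_def by (rule arrivals_add)
    moreover have "N + arrivals \<rho> u x = u x"
      using u that by (simp add: odometer_def)
    ultimately show ?thesis using a[OF that] by (simp add: w_def)
  qed
  \<comment> \<open>This is the choice for which firing \<open>w\<close> leaves no chips; by
    \<open>le\<close> the subtraction is not truncated on \<open>V\<close>.\<close>
  define \<sigma> where "\<sigma> = restrict (\<lambda>x. w x - arrivals \<rho> w x) V"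
  have \<sigma>: "\<sigma> \<in> chip_configs G s"
    by (simp add: \<sigma>_def chip_configs_def)
  obtain t where t: "odometer \<rho> \<sigma> t" "chip_action G s nxt \<sigma> \<rho> = turn \<rho> t"
    using chip_action_odometer[OF rho] by blast
  have "turn \<rho> t = turn \<rho> w"
    using rho t(1) by (rule odometer_acyclic) (use le rho'(2) turn_w in \<open>auto simp: \<sigma>_def\<close>)
  with \<sigma> t(2) turn_w show ?thesis by auto
qed

end

theorem lemma3p13:
  fixes G :: "('a, 'b) pre_digraph" and s :: 'a and nxt :: "'b \<Rightarrow> 'b"
    and \<rho> \<rho>' :: "'a \<Rightarrow> 'b"
  assumes "fin_digraph G"
    and "global_sink G s"
    and "rotor_ordering G s nxt"
    and "\<rho> \<in> rotor_configs G s" and "acyclic_rotor G s \<rho>"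
    and "\<rho>' \<in> rotor_configs G s" and "acyclic_rotor G s \<rho>'"
  shows "\<exists>\<sigma> \<in> chip_configs G s. chip_action G s nxt \<sigma> \<rho> = \<rho>'"
proof -
  interpret rotor_router G s nxt
    using assms(1-3) by (simp add: rotor_router_def rotor_router_axioms_def)
  show ?thesis
    using assms(4,6,7) by (rule chip_action_transitive)
qed

end
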